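(* Let $n$ be a positive even integer, and let $A_1,\dots,A_n$ be finite subsets of a field $F$ with $|A_1|=\cdots=|A_n|\ge 2$. Suppose that $p(F)>\sum_{i=1}^n|A_i|-2n$. Then $$|L(A_1,\dots,A_n)|\ge |C(A_1,\dots,A_n)|\ge \sum_{i=1}^n|A_i|-2n+1.$$
   Context: For finite subsets $A_1,\dots,A_n$ of a field $F$ (viewed as an additive group), $L(A_1,\dots,A_n)=\{a_1+\cdots+a_n:\ a_i\in A_i\ (1\le i\le n),\ a_i\ne a_{i+1}\text{ for all }1\le i<n\}$ and $C(A_1,\dots,A_n)=\{a_1+\cdots+a_n:\ a_i\in A_i\ (1\le i\le n),\ a_i\ne a_{i+1}\text{ for all }1\le i<n,\ \text{and } a_n\ne a_1\}$. $p(F)$ denotes the characteristic of $F$ if it is a prime, and $p(F)=+\infty$ if $F$ has characteristic $0$. *)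

theory Defs
  imports "HOL-Computational_Algebra.Computational_Algebra" "HOL-Library.Extended_Nat"
begin

(* The families A and a are functions on nat of which only the values at 1, ..., n matter. *)

definition linear_sumset :: "nat \<Rightarrow> (nat \<Rightarrow> 'a::field set) \<Rightarrow> 'a set" where
  "linear_sumset n A =
     {\<Sum>i=1..n. a i | a.
        (\<forall>i\<in>{1..n}. a i \<in> A i) \<and> (\<forall>i\<in>{1..<n}. a i \<noteq> a (i + 1))}"

definition cyclic_sumset :: "nat \<Rightarrow> (nat \<Rightarrow> 'a::field set) \<Rightarrow> 'a set" where
  "cyclic_sumset n A =
     {\<Sum>i=1..n. a i | a.
        (\<forall>i\<in>{1..n}. a i \<in> A i) \<and> (\<forall>i\<in>{1..<n}. a i \<noteq> a (i + 1)) \<and> a n \<noteq> a 1}"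

(* CHAR('a) is 0 exactly when the field 'a has characteristic 0. *)

definition field_p :: "'a::field itself \<Rightarrow> enat" where
  "field_p _ = (if CHAR('a) = 0 then \<infinity> else enat CHAR('a))"

end

theory Submission
  imports Defs "HOL-Library.FuncSet"
begin

text \<open>
  The polynomial method, with coefficient extraction replaced by a functional on the grid.
  Put \<open>m = |A i| - 1\<close> and \<open>N = n (m - 1)\<close>, and suppose that \<open>C = cyclic_sumset n A\<close> has at most \<open>N\<close>
  elements. With \<open>s = x 1 + ... + x n\<close>, some monic polynomial \<open>q\<close> of degree \<open>N\<close> vanishes on \<open>C\<close>, so
  \<open>q(s) (x 1 - x 2) ... (x n - x 1)\<close> vanishes on the grid. Its degree is \<open>n m\<close>, hence its
  coefficient at \<open>(x 1 ... x n)^m\<close> is zero. Only \<open>s^N\<close> contributes from \<open>q(s)\<close>, and the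
  coefficient of \<open>(x 1 ... x n)^m\<close> in \<open>s^N x^d\<close> is \<open>N!/(m!)^n\<close> times the product of the falling
  factorials of \<open>m\<close> of orders \<open>d i\<close>; eliminating the variables two at a time gives
  \<open>2 N! m^(n/2)/(m!)^n\<close>, which is nonzero in the field if \<open>m > 1\<close>.
  For \<open>m = 1\<close> it vanishes in characteristic 2; there only \<open>C \<noteq> {}\<close> is claimed, and the sets can be
  moved injectively into the rationals.
\<close>

section \<open>Falling factorials in a commutative ring\<close>

text \<open>Subtraction is that of the ring, so the factors
  \<open>of_nat (m k) - of_nat (d k)\<close> can later be summed over \<open>k\<close> without
  truncation.\<close>

definition falling :: "nat \<Rightarrow> nat \<Rightarrow> 'a::comm_ring_1" where
  "falling m d = (\<Prod>i<d. of_nat m - of_nat i)"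

lemma falling_0 [simp]: "falling m 0 = 1"
  by (simp add: falling_def)

lemma falling_Suc: "falling m (Suc d) = falling m d * (of_nat m - of_nat d)"
  by (simp add: falling_def)

lemma falling_eq_0: "m < d \<Longrightarrow> falling m d = 0"
  by (auto simp: falling_def intro!: prod_zero)

lemma falling_self: "falling m m = of_nat (fact m)"
proof -
  have "falling m m = (\<Prod>i<m. of_nat (m - i) :: 'a)"
    unfolding falling_def by (intro prod.cong) (auto simp: of_nat_diff)
  also have "\<dots> = of_nat (\<Prod>i<m. m - i)"
    by simp
  also have "(\<Prod>i<m. m - i) = fact m"
    by (simp add: fact_prod_rev atLeast0LessThan)
  finally show ?thesis .
qed

section \<open>Divided-difference weights on a finite set\<close>

text \<open>These are the weights of a divided difference. Adding a point \<open>b\<close> divides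
  the old weights by \<open>a - b\<close>, and \<open>(a ^ j - b ^ j) / (a - b)\<close> expands into
  powers of \<open>a\<close> below \<open>j\<close>, where the induction hypothesis applies.\<close>

lemma lagrange_weights:
  fixes A :: "'a::field set"
  assumes "finite A" and "card A = Suc m"
  shows "\<exists>c. \<forall>j\<le>m. (\<Sum>a\<in>A. c a * a ^ j) = of_bool (j = m)"
  using assms
proof (induction m arbitrary: A)
  case 0
  then obtain b where "A = {b}"
    by (auto simp: card_Suc_eq)
  then show ?case
    by (intro exI[of _ "\<lambda>_. 1"]) simp
next
  case (Suc m)
  obtain b B where B: "A = insert b B" "b \<notin> B" "card B = Suc m"
    using Suc.prems card_Suc_eq[of A "Suc m"] by blast
  have fin: "finite B"
    using Suc.prems B by simp
  obtain c where c: "\<And>j. j \<le> m \<Longrightarrow> (\<Sum>a\<in>B. c a * a ^ j) = of_bool (j = m)"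
    using Suc.IH[OF fin B(3)] by blast
  \<comment> \<open>The weight at \<open>b\<close> makes the total weight zero, so
    \<open>a ^ j\<close> can be replaced by \<open>a ^ j - b ^ j\<close>.\<close>
  define e where "e a = (if a = b then - (\<Sum>x\<in>B. c x / (x - b)) else c a / (a - b))" for a
  have "(\<Sum>a\<in>A. e a * a ^ j) = of_bool (j = Suc m)" if j: "j \<le> Suc m" for j
  proof -
    have "(\<Sum>a\<in>A. e a * a ^ j) = e b * b ^ j + (\<Sum>a\<in>B. e a * a ^ j)"
      using B fin by simp
    also have "(\<Sum>a\<in>B. e a * a ^ j) = (\<Sum>a\<in>B. c a / (a - b) * a ^ j)"
      using B by (intro sum.cong) (auto simp: e_def)
    also have "e b * b ^ j + \<dots> = (\<Sum>a\<in>B. c a / (a - b) * (a ^ j - b ^ j))"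
      by (simp add: e_def sum_distrib_right sum_subtractf right_diff_distrib)
    also have "\<dots> = (\<Sum>a\<in>B. \<Sum>l<j. b ^ (j - Suc l) * (c a * a ^ l))"
    proof (intro sum.cong refl)
      fix a assume "a \<in> B"
      then have "a - b \<noteq> 0"
        using B by auto
      then have "c a / (a - b) * (a ^ j - b ^ j) = c a * (\<Sum>l<j. b ^ (j - Suc l) * a ^ l)"
        unfolding power_diff_sumr2 by simp
      then show "c a / (a - b) * (a ^ j - b ^ j) = (\<Sum>l<j. b ^ (j - Suc l) * (c a * a ^ l))"
        by (simp add: sum_distrib_left mult_ac)
    qed
    also have "\<dots> = (\<Sum>l<j. b ^ (j - Suc l) * (\<Sum>a\<in>B. c a * a ^ l))"
      by (subst sum.swap) (simp add: sum_distrib_left)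
    also have "\<dots> = (\<Sum>l<j. b ^ (j - Suc l) * of_bool (l = m))"
      using j by (intro sum.cong) (auto simp: c)
    also have "\<dots> = of_bool (j = Suc m)"
    proof (cases "j = Suc m")
      case True
      then show ?thesis
        by simp
    next
      case False
      then show ?thesis
        using j by (auto intro!: sum.neutral)
    qed
    finally show ?thesis .
  qed
  then show ?case
    by blast
qed

section \<open>The coefficient functional on a grid\<close>

lemma sum_update:
  fixes d :: "'i \<Rightarrow> nat"
  assumes "finite I" and "k \<in> I"
  shows "sum (d(k := Suc (d k))) I = Suc (sum d I)"
proof -
  have "sum (d(k := Suc (d k))) (I - {k}) = sum d (I - {k})"
    by (intro sum.cong) auto
  then show ?thesis
    using assms by (simp add: sum.remove[of I k])
qed

text \<open>The sizes of the factors enter only through \<open>moment\<close>, which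
  \<open>lagrange_weights\<close> supplies when \<open>A i\<close> has \<open>m i + 1\<close>
  elements.\<close>

locale weighted_grid =
  fixes I :: "'i set" and A :: "'i \<Rightarrow> 'a::field set" and m :: "'i \<Rightarrow> nat"
    and c :: "'i \<Rightarrow> 'a \<Rightarrow> 'a"
  assumes finite_index: "finite I"
    and finite_factor: "i \<in> I \<Longrightarrow> finite (A i)"
    and moment: "i \<in> I \<Longrightarrow> j \<le> m i \<Longrightarrow> (\<Sum>a\<in>A i. c i a * a ^ j) = of_bool (j = m i)"
begin

text \<open>On functions given by polynomials of degree at most \<open>sum m I\<close> this is the coefficient of
  \<open>\<Prod>i\<in>I. x i ^ m i\<close>.\<close>

definition functional :: "(('i \<Rightarrow> 'a) \<Rightarrow> 'a) \<Rightarrow> 'a" where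
  "functional f = (\<Sum>a\<in>PiE I A. (\<Prod>i\<in>I. c i (a i)) * f a)"

definition monomial :: "('i \<Rightarrow> nat) \<Rightarrow> ('i \<Rightarrow> 'a) \<Rightarrow> 'a" where
  "monomial d a = (\<Prod>i\<in>I. a i ^ d i)"

lemma functional_cong: "(\<And>a. a \<in> PiE I A \<Longrightarrow> f a = g a) \<Longrightarrow> functional f = functional g"
  by (simp add: functional_def)

lemma functional_diff: "functional (\<lambda>a. f a - g a) = functional f - functional g"
  by (simp add: functional_def right_diff_distrib sum_subtractf)

lemma functional_sum: "functional (\<lambda>a. \<Sum>x\<in>X. f x a) = (\<Sum>x\<in>X. functional (f x))"
  unfolding functional_def sum_distrib_left by (rule sum.swap)

lemma functional_scale: "functional (\<lambda>a. r * f a) = r * functional f"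
  by (simp add: functional_def sum_distrib_left mult_ac)

lemma monomial_update:
  assumes "k \<in> I"
  shows "monomial (d(k := Suc (d k))) a = a k * monomial d a"
proof -
  have "(\<Prod>i\<in>I - {k}. a i ^ (d(k := Suc (d k))) i) = (\<Prod>i\<in>I - {k}. a i ^ d i)"
    by (intro prod.cong) auto
  then show ?thesis
    using assms finite_index by (simp add: monomial_def prod.remove[of I k])
qed

lemma functional_monomial: "functional (monomial d) = (\<Prod>i\<in>I. \<Sum>a\<in>A i. c i a * a ^ d i)"
  using finite_index finite_factor
  by (simp add: functional_def monomial_def prod_sum_PiE prod.distrib)

lemma functional_monomial_low:
  assumes "i \<in> I" and "d i < m i"
  shows "functional (monomial d) = 0"
  unfolding functional_monomial
  using finite_index assms moment[of i "d i"] by (intro prod_zero) auto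

text \<open>Distributing one factor \<open>sum a I\<close> raises one exponent at a time. This
  recursion takes the place of the multinomial theorem.\<close>

lemma functional_power_Suc:
  "functional (\<lambda>a. sum a I ^ Suc j * monomial d a) =
     (\<Sum>k\<in>I. functional (\<lambda>a. sum a I ^ j * monomial (d(k := Suc (d k))) a))"
  by (simp add: sum_distrib_left sum_distrib_right mult_ac monomial_update flip: functional_sum)

text \<open>The degree is too small for every exponent to reach \<open>m i\<close>, and a monomial
  with an exponent below \<open>m i\<close> is sent to zero.\<close>

lemma functional_power_monomial_low:
  assumes "j + sum d I < sum m I"
  shows "functional (\<lambda>a. sum a I ^ j * monomial d a) = 0"
  using assms
proof (induction j arbitrary: d)
  case 0
  then obtain i where "i \<in> I" "d i < m i"
    by (metis add_0 not_less sum_mono)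
  then show ?case
    by (simp add: functional_monomial_low)
next
  case (Suc j)
  have "functional (\<lambda>a. sum a I ^ j * monomial (d(k := Suc (d k))) a) = 0" if "k \<in> I" for k
    using Suc.prems that by (intro Suc.IH) (simp add: sum_update finite_index del: fun_upd_apply)
  then show ?case
    unfolding functional_power_Suc by simp
qed

text \<open>Raising \<open>d k\<close> multiplies the product of falling factorials by
  \<open>m k - d k\<close>. These factors add up to the missing degree \<open>Suc j\<close>, which
  turns \<open>fact j\<close> into \<open>fact (Suc j)\<close>. Multiplying by the factorials of the
  \<open>m i\<close> keeps the identity free of division, in any characteristic.\<close>

lemma functional_power_monomial:
  assumes "j + sum d I = sum m I"
  shows "functional (\<lambda>a. sum a I ^ j * monomial d a) * (\<Prod>i\<in>I. of_nat (fact (m i))) =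
     of_nat (fact j) * (\<Prod>i\<in>I. falling (m i) (d i))"
  using assms
proof (induction j arbitrary: d)
  case 0
  show ?case
  proof (cases "\<forall>i\<in>I. d i = m i")
    case True
    then have "functional (monomial d) = 1"
      unfolding functional_monomial by (simp add: moment)
    with True show ?thesis
      by (simp add: falling_self)
  next
    \<comment> \<open>The totals agree, so some exponent lies below \<open>m i\<close>, which kills
      the functional, and some other lies above, which kills a falling factorial.\<close>
    case False
    have "\<exists>i\<in>I. d i < m i"
    proof (rule ccontr)
      assume *: "\<not> ?thesis"
      with False obtain i where "i \<in> I" "m i < d i"
        by (meson nat_neq_iff)
      with * have "sum m I < sum d I"
        using finite_index by (intro sum_strict_mono_ex1) (auto simp: not_less)
      with 0 show False
        by simp
    qed
    then have low: "functional (monomial d) = 0"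
      by (auto simp: functional_monomial_low)
    have "\<exists>i\<in>I. m i < d i"
    proof (rule ccontr)
      assume *: "\<not> ?thesis"
      with False obtain i where "i \<in> I" "d i < m i"
        by (meson nat_neq_iff)
      with * have "sum d I < sum m I"
        using finite_index by (intro sum_strict_mono_ex1) (auto simp: not_less)
      with 0 show False
        by simp
    qed
    then have "(\<Prod>i\<in>I. falling (m i) (d i)) = (0 :: 'a)"
      using finite_index by (auto intro!: prod_zero falling_eq_0)
    with low show ?thesis
      by simp
  qed
next
  case (Suc j)
  have up: "(\<Prod>i\<in>I. falling (m i) ((d(k := Suc (d k))) i)) =
      (\<Prod>i\<in>I. falling (m i) (d i)) * (of_nat (m k) - of_nat (d k) :: 'a)" if "k \<in> I" for k
  proof -
    have "(\<Prod>i\<in>I - {k}. falling (m i) ((d(k := Suc (d k))) i) :: 'a) =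
        (\<Prod>i\<in>I - {k}. falling (m i) (d i))"
      by (intro prod.cong) auto
    then show ?thesis
      using that finite_index by (simp add: prod.remove[of I k] falling_Suc mult_ac)
  qed
  have "functional (\<lambda>a. sum a I ^ Suc j * monomial d a) * (\<Prod>i\<in>I. of_nat (fact (m i))) =
      (\<Sum>k\<in>I. of_nat (fact j) * (\<Prod>i\<in>I. falling (m i) ((d(k := Suc (d k))) i)))"
    unfolding functional_power_Suc sum_distrib_right
    using Suc.prems by (intro sum.cong refl Suc.IH) (simp add: sum_update finite_index del: fun_upd_apply)
  also have "\<dots> = (\<Sum>k\<in>I. of_nat (fact j) * ((\<Prod>i\<in>I. falling (m i) (d i)) *
      (of_nat (m k) - of_nat (d k))))"
    by (intro sum.cong refl) (simp only: up)
  also have "\<dots> = of_nat (fact j) * (\<Prod>i\<in>I. falling (m i) (d i)) *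
      (of_nat (sum m I) - of_nat (sum d I))"
    by (simp add: mult.assoc sum_subtractf flip: sum_distrib_left)
  also have "of_nat (sum m I) - of_nat (sum d I) = (of_nat (Suc j) :: 'a)"
    unfolding Suc.prems[symmetric] by simp
  finally show ?case
    by (simp add: algebra_simps)
qed

text \<open>Only the leading term of \<open>q\<close> reaches the total degree
  \<open>sum m I\<close>.\<close>

lemma functional_poly_monomial:
  assumes "degree q + sum d I = sum m I" and "lead_coeff q = 1"
  shows "functional (\<lambda>a. poly q (sum a I) * monomial d a) * (\<Prod>i\<in>I. of_nat (fact (m i))) =
     of_nat (fact (degree q)) * (\<Prod>i\<in>I. falling (m i) (d i))"
proof -
  have "functional (\<lambda>a. poly q (sum a I) * monomial d a) =
      (\<Sum>j\<le>degree q. coeff q j * functional (\<lambda>a. sum a I ^ j * monomial d a))"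
    by (simp add: poly_altdef sum_distrib_right functional_sum mult.assoc flip: functional_scale)
  also have "\<dots> = (\<Sum>j\<in>{degree q}. coeff q j * functional (\<lambda>a. sum a I ^ j * monomial d a))"
    using assms(1) by (intro sum.mono_neutral_right) (auto simp: functional_power_monomial_low)
  also have "\<dots> = functional (\<lambda>a. sum a I ^ degree q * monomial d a)"
    using assms(2) by simp
  finally show ?thesis
    using functional_power_monomial[OF assms(1)] by simp
qed

end

section \<open>The product of differences along a path and around a cycle\<close>

text \<open>Here \<open>U k d\<close> stands for the value on \<open>x^d (x k - x (k + 1)) ... (x (n - 1) - x n)\<close> of a functional that
  sends \<open>x^d\<close> to \<open>K\<close> times a product of falling factorials. Under it
  \<open>(u - x) (x - y) (y - v)\<close> integrates over \<open>x\<close> and \<open>y\<close> to \<open>m (u - v)\<close>.\<close>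

lemma path_elimination:
  fixes U :: "nat \<Rightarrow> (nat \<Rightarrow> nat) \<Rightarrow> 'a::comm_ring_1"
  assumes edge: "\<And>k d. 1 \<le> k \<Longrightarrow> k < n \<Longrightarrow>
      U k d = U (Suc k) (d(k := Suc (d k))) - U (Suc k) (d(Suc k := Suc (d (Suc k))))"
    and final: "\<And>d. sum d {1..n} = n \<Longrightarrow> U n d = K * (\<Prod>i\<in>{1..n}. falling m (d i))"
    and "1 \<le> k" and "k + Suc (2 * j) = n" and "sum d {1..n} = k"
    and "\<And>i. k < i \<Longrightarrow> i < n \<Longrightarrow> d i = 0"
  shows "U k d = K * of_nat m ^ j * ((\<Prod>i\<in>{1..n}. falling m ((d(k := Suc (d k))) i)) -
      (\<Prod>i\<in>{1..n}. falling m ((d(n := Suc (d n))) i)))"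
  using assms(3-)
proof (induction j arbitrary: k d)
  case 0
  then have n: "n = Suc k"
    by simp
  have mem: "k \<in> {1..n}" "n \<in> {1..n}"
    using 0 n by auto
  have sums: "sum (d(k := Suc (d k))) {1..n} = n" "sum (d(n := Suc (d n))) {1..n} = n"
    using sum_update[OF _ mem(1), of d] sum_update[OF _ mem(2), of d] 0(3) n
    by (metis finite_atLeastAtMost)+
  have "U k d = U n (d(k := Suc (d k))) - U n (d(n := Suc (d n)))"
    using edge[of k d] 0 n by simp
  also have "U n (d(k := Suc (d k))) = K * (\<Prod>i\<in>{1..n}. falling m ((d(k := Suc (d k))) i))"
    by (intro final sums)
  also have "U n (d(n := Suc (d n))) = K * (\<Prod>i\<in>{1..n}. falling m ((d(n := Suc (d n))) i))"
    by (intro final sums)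
  finally show ?case
    by (simp only: power_0 mult_1_right right_diff_distrib)
next
  case (Suc j)
  \<comment> \<open>The two variables to eliminate; neither occurs in \<open>d\<close>.\<close>
  define x y where "x = Suc k" and "y = Suc (Suc k)"
  have d0: "d x = 0" "d y = 0"
    using Suc.prems by (auto simp: x_def y_def)
  have ineq: "k \<noteq> x" "k \<noteq> y" "x \<noteq> y" "k \<noteq> n" "x \<noteq> n" "y \<noteq> n"
    and mem: "k \<in> {1..n}" "x \<in> {1..n}" "y \<in> {1..n}"
    using Suc.prems by (auto simp: x_def y_def)
  define P where "P d = (\<Prod>i\<in>{1..n}. falling m (d i) :: 'a)" for d
  \<comment> \<open>The part of \<open>P\<close> that updates at \<open>x\<close> and
    \<open>y\<close> leave unchanged.\<close>
  define R where "R d = (\<Prod>i\<in>{1..n} - {x} - {y}. falling m (d i) :: 'a)" for d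
  have P: "P d = falling m (d x) * (falling m (d y) * R d)" for d
  proof -
    have y: "y \<in> {1..n} - {x}"
      using mem ineq by blast
    show ?thesis
      unfolding P_def R_def prod.remove[OF finite_atLeastAtMost mem(2)]
        prod.remove[OF finite_Diff[OF finite_atLeastAtMost] y] ..
  qed
  have Rx: "R (d(x := r)) = R d" for d r
    unfolding R_def by (intro prod.cong) auto
  have Ry: "R (d(y := r)) = R d" for d r
    unfolding R_def by (intro prod.cong) auto
  define Rk Rn where "Rk = R (d(k := Suc (d k)))" and "Rn = R (d(n := Suc (d n)))"
  define Rkn where "Rkn = R (d(k := Suc (d k), n := Suc (d n)))"
  have IH: "U y e = K * of_nat m ^ j * (P (e(y := Suc (e y))) - P (e(n := Suc (e n))))"
    if "sum e {1..n} = y" "\<And>i. y < i \<Longrightarrow> i < n \<Longrightarrow> e i = 0" for e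
    unfolding P_def using Suc.prems that by (intro Suc.IH) (auto simp: y_def)
  have xy: "Suc k = x" "Suc x = y"
    by (simp_all add: x_def y_def)
  have x_less: "Suc 0 \<le> x" "x < n"
    using Suc.prems by (auto simp: x_def)
  \<comment> \<open>The edges from \<open>k\<close> to \<open>x\<close> and from \<open>x\<close> to
    \<open>y\<close> are expanded; the rest of the path starts at \<open>y\<close>, as the induction
    hypothesis requires.\<close>
  have U: "U k d = U y (d(k := Suc (d k), x := 1)) - U y (d(k := Suc (d k), y := 1)) -
      (U y (d(x := 2)) - U y (d(x := 1, y := 1)))"
    using edge[of k d] edge[of x "d(k := Suc (d k))"] edge[of x "d(x := 1)"] Suc.prems(1,2) ineq d0
    by (simp add: xy x_less numeral_2_eq_2)
  have su: "sum (e(i := v)) {1..n} = Suc (sum e {1..n})" if "v = Suc (e i)" "i \<in> {1..n}" for e i v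
    using that sum_update[of "{1..n}" i e] by simp
  note [simp del] = fun_upd_apply
  note upd = fun_upd_apply
  have "sum (d(k := Suc (d k))) {1..n} = x" "sum (d(x := 1)) {1..n} = x"
    using su[of "Suc (d k)" d k] su[of 1 d x] Suc.prems(3) d0 mem by (simp_all add: xy)
  moreover have "sum (d(k := Suc (d k), x := 1)) {1..n} = Suc (sum (d(k := Suc (d k))) {1..n})"
    "sum (d(k := Suc (d k), y := 1)) {1..n} = Suc (sum (d(k := Suc (d k))) {1..n})"
    "sum (d(x := 1, y := 1)) {1..n} = Suc (sum (d(x := 1)) {1..n})"
    "sum (d(x := 1, x := 2)) {1..n} = Suc (sum (d(x := 1)) {1..n})"
    by (rule su, simp add: upd ineq ineq[symmetric] d0, rule mem)+
  ultimately have sums: "sum (d(k := Suc (d k), x := 1)) {1..n} = y"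
    "sum (d(k := Suc (d k), y := 1)) {1..n} = y"
    "sum (d(x := 1, y := 1)) {1..n} = y" "sum (d(x := 2)) {1..n} = y"
    by (simp_all only: xy fun_upd_upd)
  have zeros: "d i = 0" "i \<noteq> k" "i \<noteq> x" "i \<noteq> y" if "y < i" "i < n" for i
    using that Suc.prems by (auto simp: x_def y_def)
  have w: "falling m (Suc 0) = (of_nat m :: 'a)" "falling m 1 = (of_nat m :: 'a)"
    "falling m 2 = of_nat m * (of_nat m - 1 :: 'a)" "falling m (Suc (Suc 0)) = of_nat m * (of_nat m - 1 :: 'a)"
    by (simp_all add: falling_def numeral_2_eq_2)
  \<comment> \<open>Updates at \<open>x\<close> and \<open>y\<close> are moved outermost, where
    \<open>Rx\<close> and \<open>Ry\<close> can remove them.\<close>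
  have swap: "d(x := u, n := v) = d(n := v, x := u)" "d(y := u, n := v) = d(n := v, y := u)" for d u v
    using ineq by (simp_all add: fun_upd_twist)
  note eval = P upd w swap Rx Ry ineq ineq[symmetric] d0 Rk_def[symmetric] Rn_def[symmetric] Rkn_def[symmetric]
    if_True if_False refl mult_1_left mult_1_right falling_0 Suc_1 One_nat_def
  have 1: "U y (d(k := Suc (d k), x := 1)) = K * of_nat m ^ j * (of_nat m * (of_nat m * Rk) - of_nat m * Rkn)"
    by (subst IH[OF sums(1)]) (use zeros in \<open>simp add: upd\<close>, simp only: eval)
  have 2: "U y (d(k := Suc (d k), y := 1)) = K * of_nat m ^ j * (of_nat m * (of_nat m - 1) * Rk - of_nat m * Rkn)"
    by (subst IH[OF sums(2)]) (use zeros in \<open>simp add: upd\<close>, simp only: eval)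
  have 3: "U y (d(x := 2)) = K * of_nat m ^ j *
      (of_nat m * (of_nat m - 1) * (of_nat m * R d) - of_nat m * (of_nat m - 1) * Rn)"
    by (subst IH[OF sums(4)]) (use zeros in \<open>simp add: upd\<close>, simp only: eval)
  have 4: "U y (d(x := 1, y := 1)) = K * of_nat m ^ j *
      (of_nat m * (of_nat m * (of_nat m - 1) * R d) - of_nat m * (of_nat m * Rn))"
    by (subst IH[OF sums(3)]) (use zeros in \<open>simp add: upd\<close>, simp only: eval)
  \<comment> \<open>The \<open>Rkn\<close> terms cancel between \<open>1\<close> and
    \<open>2\<close>, the \<open>R d\<close> terms between \<open>3\<close> and
    \<open>4\<close>.\<close>
  have "U k d = K * of_nat m ^ Suc j * (Rk - Rn)"
    unfolding U 1 2 3 4 by (simp add: algebra_simps)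
  moreover have "Rk = P (d(k := Suc (d k)))" "Rn = P (d(n := Suc (d n)))"
    using ineq d0 by (simp_all add: P Rk_def Rn_def upd)
  ultimately show ?case
    by (simp add: P_def)
qed

text \<open>The closing edge \<open>a n - a 1\<close> is split into its two monomials, leaving a
  path from \<open>1\<close> to \<open>n\<close> with \<open>j\<close> pairs of inner variables. The
  two path values are opposite, so their difference doubles; hence the factor 2.\<close>

lemma functional_even_cycle:
  fixes A :: "nat \<Rightarrow> 'a::field set"
  assumes grid: "weighted_grid {1..n} A (\<lambda>_. r) c"
    and r: "r \<ge> 1" and n: "n = 2 * Suc j"
    and q: "degree q = n * (r - 1)" "lead_coeff q = 1"
  shows "weighted_grid.functional {1..n} A c (\<lambda>a. poly q (sum a {1..n}) * ((\<Prod>i\<in>{1..<n}. a i - a (Suc i)) * (a n - a 1))) *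
      of_nat (fact r) ^ n = 2 * of_nat (fact (n * (r - 1))) * of_nat r ^ Suc j"
proof -
  interpret weighted_grid "{1..n}" A "\<lambda>_. r" c
    by (fact grid)
  define U where "U k d = functional (\<lambda>a. poly q (sum a {1..n}) * monomial d a * (\<Prod>i\<in>{k..<n}. a i - a (Suc i))) *
      of_nat (fact r) ^ n" for k d
  define P where "P d = (\<Prod>i\<in>{1..n}. falling r (d i) :: 'a)" for d
  define K :: 'a where "K = of_nat (fact (n * (r - 1)))"
  have edge: "U k d = U (Suc k) (d(k := Suc (d k))) - U (Suc k) (d(Suc k := Suc (d (Suc k))))"
    if "1 \<le> k" "k < n" for k d
  proof -
    have mem: "k \<in> {1..n}" "Suc k \<in> {1..n}"
      using that by auto
    have "{k..<n} = insert k {Suc k..<n}"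
      using that by auto
    then show ?thesis
      unfolding U_def left_diff_distrib[symmetric] functional_diff[symmetric]
        monomial_update[OF mem(1)] monomial_update[OF mem(2)]
      by (simp add: algebra_simps)
  qed
  have final: "U n d = K * P d" if "sum d {1..n} = n" for d
  proof -
    \<comment> \<open>The \<open>n\<close> differences supply total degree \<open>n\<close>, and
      \<open>n * (r - 1) + n = n * r\<close> since \<open>r \<ge> 1\<close>.\<close>
    have "degree q + sum d {1..n} = (\<Sum>i=1..n. r)"
      using that r q by (cases r) auto
    from functional_poly_monomial[OF this q(2)] show ?thesis
      using q by (simp add: U_def K_def P_def)
  qed
  define d1 dn :: "nat \<Rightarrow> nat" where "d1 = (\<lambda>_. 0)(1 := 1)" and "dn = (\<lambda>_. 0)(n := 1)"
  have path: "U 1 d = K * of_nat r ^ j * (P (d(1 := Suc (d 1))) - P (d(n := Suc (d n))))"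
    if "sum d {1..n} = 1" "\<And>i. 1 < i \<Longrightarrow> i < n \<Longrightarrow> d i = 0" for d
    unfolding P_def using that n
    by (intro path_elimination[of n U K r 1 j d] edge final[unfolded P_def]) auto
  have P: "P d = falling r (d 1) * falling r (d n)" if "\<And>i. 1 < i \<Longrightarrow> i < n \<Longrightarrow> d i = 0" for d
  proof -
    have "{1..n} = insert 1 (insert n {1<..<n})"
      using n by auto
    moreover have "(\<Prod>i\<in>{1<..<n}. falling r (d i)) = (1 :: 'a)"
      using that by (intro prod.neutral) auto
    ultimately show ?thesis
      using n by (simp add: P_def mult_ac)
  qed
  have w: "falling r (Suc 0) = (of_nat r :: 'a)" "falling r (Suc (Suc 0)) = of_nat r * (of_nat r - 1 :: 'a)"
    by (simp_all add: falling_def)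
  have s: "sum d1 {1..n} = 1" "sum dn {1..n} = 1"
    using n by (simp_all add: d1_def dn_def fun_upd_def)
  have "U 1 dn = K * of_nat r ^ j * (of_nat r * of_nat r - of_nat r * (of_nat r - 1))"
    using n by (subst path[OF s(2)]) (auto simp: dn_def P w)
  moreover have "U 1 d1 = K * of_nat r ^ j * (of_nat r * (of_nat r - 1) - of_nat r * of_nat r)"
    using n by (subst path[OF s(1)]) (auto simp: d1_def P w)
  moreover have "functional (\<lambda>a. poly q (sum a {1..n}) * ((\<Prod>i\<in>{1..<n}. a i - a (Suc i)) * (a n - a 1))) *
      of_nat (fact r) ^ n = U 1 dn - U 1 d1"
  proof -
    have mem: "n \<in> {1..n}" "1 \<in> {1..n}"
      using n by auto
    have mono0: "monomial (\<lambda>_. 0) a = 1" for a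
      by (simp only: monomial_def power_0 prod.neutral_const)
    have "monomial dn a = a n * monomial (\<lambda>_. 0) a" "monomial d1 a = a 1 * monomial (\<lambda>_. 0) a" for a
      using monomial_update[OF mem(1), of "\<lambda>_. 0" a] monomial_update[OF mem(2), of "\<lambda>_. 0" a]
      by (simp_all add: dn_def d1_def)
    then have "monomial dn a = a n" "monomial d1 a = a 1" for a
      by (simp_all only: mono0 mult_1_right)
    then show ?thesis
      unfolding U_def left_diff_distrib[symmetric] functional_diff[symmetric]
      by (simp add: algebra_simps)
  qed
  ultimately show ?thesis
    by (simp add: K_def algebra_simps)
qed

section \<open>The lower bound for the cyclic sumset\<close>

lemma finite_linear_sumset:
  assumes "\<forall>i\<in>{1..n}. finite (A i)"
  shows "finite (linear_sumset n A)"
proof (rule finite_subset)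
  show "linear_sumset n A \<subseteq> (\<lambda>a. \<Sum>i=1..n. a i) ` PiE {1..n} A"
  proof
    fix s assume "s \<in> linear_sumset n A"
    then obtain a where a: "s = (\<Sum>i=1..n. a i)" "\<forall>i\<in>{1..n}. a i \<in> A i"
      unfolding linear_sumset_def by blast
    then have "s = (\<Sum>i=1..n. restrict a {1..n} i)" "restrict a {1..n} \<in> PiE {1..n} A"
      by auto
    then show "s \<in> (\<lambda>a. \<Sum>i=1..n. a i) ` PiE {1..n} A"
      by blast
  qed
  show "finite ((\<lambda>a. \<Sum>i=1..n. a i) ` PiE {1..n} A)"
    using assms by (intro finite_imageI finite_PiE) auto
qed

lemma cyclic_subset_linear: "cyclic_sumset n A \<subseteq> linear_sumset n A"
  unfolding cyclic_sumset_def linear_sumset_def by blast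

text \<open>\<open>nz\<close> collects the factors of the value in
  \<open>functional_even_cycle\<close>; a sumset that is too small would force that value to be
  zero.\<close>

lemma card_cyclic_sumset_gt:
  fixes A :: "nat \<Rightarrow> 'a::field set"
  assumes n: "n > 0" "even n"
    and A: "\<And>i. i \<in> {1..n} \<Longrightarrow> finite (A i)" "\<And>i. i \<in> {1..n} \<Longrightarrow> card (A i) = Suc r"
    and r: "r \<ge> 1"
    and nz: "of_nat (2 * fact (n * (r - 1)) * r) \<noteq> (0 :: 'a)"
  shows "n * (r - 1) < card (cyclic_sumset n A)"
proof (rule ccontr)
  assume small: "\<not> n * (r - 1) < card (cyclic_sumset n A)"
  define C where "C = cyclic_sumset n A"
  have fin: "finite C"
    unfolding C_def using A(1) finite_linear_sumset cyclic_subset_linear by (metis finite_subset)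
  have le: "card C \<le> n * (r - 1)"
    using small by (simp add: C_def)
  have "\<forall>i\<in>{1..n}. \<exists>c. \<forall>j\<le>r. (\<Sum>a\<in>A i. c a * a ^ j) = of_bool (j = r)"
    using lagrange_weights[OF A] by blast
  then obtain c where c: "\<And>i j. i \<in> {1..n} \<Longrightarrow> j \<le> r \<Longrightarrow> (\<Sum>a\<in>A i. c i a * a ^ j) = of_bool (j = r)"
    by metis
  interpret weighted_grid "{1..n}" A "\<lambda>_. r" c
    using A c by unfold_locales auto
  \<comment> \<open>The power of the variable pads the degree to exactly \<open>n * (r - 1)\<close>
    when \<open>C\<close> is smaller.\<close>
  define q where "q = monom 1 (n * (r - 1) - card C) * (\<Prod>s\<in>C. [:- s, 1:])"
  have q: "degree q = n * (r - 1)" "lead_coeff q = 1"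
  proof -
    define u where "u = (\<Prod>s\<in>C. [:- s, 1:])"
    have u: "degree u = card C" "lead_coeff u = 1"
      unfolding u_def lead_coeff_prod by (simp_all add: degree_prod_sum_eq)
    then have "u \<noteq> 0"
      by auto
    then show "degree q = n * (r - 1)"
      using u le by (simp add: q_def degree_mult_eq degree_monom_eq monom_eq_0_iff flip: u_def)
    show "lead_coeff q = 1"
      using u unfolding q_def lead_coeff_mult by (simp add: degree_monom_eq flip: u_def)
  qed
  obtain j where j: "n = 2 * Suc j"
    using n by (metis dvd_def gr0_implies_Suc mult_0_right neq0_conv)
  have "functional (\<lambda>a. poly q (sum a {1..n}) * ((\<Prod>i\<in>{1..<n}. a i - a (Suc i)) * (a n - a 1))) =
      functional (\<lambda>a. 0)"
  proof (rule functional_cong)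
    fix a assume a: "a \<in> PiE {1..n} A"
    show "poly q (sum a {1..n}) * ((\<Prod>i\<in>{1..<n}. a i - a (Suc i)) * (a n - a 1)) = 0"
    \<comment> \<open>Either the sum is a root of \<open>q\<close>, or one of the differences is
      zero.\<close>
    proof (cases "(\<forall>i\<in>{1..<n}. a i \<noteq> a (i + 1)) \<and> a n \<noteq> a 1")
      case True
      then have "sum a {1..n} \<in> C"
        using a unfolding C_def cyclic_sumset_def by (auto simp: PiE_iff)
      then have "poly q (sum a {1..n}) = 0"
        using fin by (auto simp: q_def poly_prod)
      then show ?thesis
        by simp
    next
      case False
      then show ?thesis
        by auto
    qed
  qed
  also have "\<dots> = 0"
    unfolding functional_def by simp
  finally have "2 * of_nat (fact (n * (r - 1))) * of_nat r ^ Suc j = (0 :: 'a)"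
    using functional_even_cycle[OF weighted_grid_axioms r j q] by simp
  with nz show False
    by (simp only: of_nat_mult mult_eq_0_iff power_eq_0_iff) simp
qed

text \<open>Even cycles are 2-choosable. Only equality of elements matters, so they can be
  relabelled in \<open>rat\<close>, where 2 is nonzero.\<close>

lemma even_cycle_choosable:
  fixes A :: "nat \<Rightarrow> 'a::field set"
  assumes n: "n > 0" "even n"
    and A: "\<And>i. i \<in> {1..n} \<Longrightarrow> finite (A i)" "\<And>i. i \<in> {1..n} \<Longrightarrow> card (A i) = 2"
  shows "cyclic_sumset n A \<noteq> {}"
proof -
  have "finite (\<Union>i\<in>{1..n}. A i)"
    using A by auto
  then obtain g :: "'a \<Rightarrow> nat" where "inj_on g (\<Union>i\<in>{1..n}. A i)"
    using finite_imp_inj_to_nat_seg by metis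
  define f where "f x = rat_of_nat (g x)" for x
  have f: "inj_on f (\<Union>i\<in>{1..n}. A i)"
    using \<open>inj_on g _\<close> by (auto simp: f_def inj_on_def)
  have "card (f ` A i) = Suc 1" if "i \<in> {1..n}" for i
  proof -
    have "inj_on f (A i)"
      using that by (intro inj_on_subset[OF f]) blast
    then show ?thesis
      using that A(2)[of i] by (simp add: card_image)
  qed
  \<comment> \<open>For \<open>r = 1\<close> the bound reads \<open>0 < card\<close>, that is,
    nonemptiness.\<close>
  then have "n * (1 - 1) < card (cyclic_sumset n (\<lambda>i. f ` A i))"
    using n A by (intro card_cyclic_sumset_gt) auto
  then have "cyclic_sumset n (\<lambda>i. f ` A i) \<noteq> {}"
    by auto
  then obtain b where b: "\<forall>i\<in>{1..n}. b i \<in> f ` A i" "\<forall>i\<in>{1..<n}. b i \<noteq> b (i + 1)" "b n \<noteq> b 1"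
    unfolding cyclic_sumset_def by auto
  then obtain a where a: "\<And>i. i \<in> {1..n} \<Longrightarrow> a i \<in> A i \<and> b i = f (a i)"
    unfolding image_iff by metis
  have "a i \<noteq> a (i + 1)" if "i \<in> {1..<n}" for i
  proof -
    have "b i \<noteq> b (i + 1)" "i \<in> {1..n}" "i + 1 \<in> {1..n}"
      using b(2) that by auto
    with a show ?thesis
      by metis
  qed
  moreover have "a n \<noteq> a 1"
    using b(3) n a[of n] a[of 1] by auto
  ultimately have "(\<Sum>i=1..n. a i) \<in> cyclic_sumset n A"
    using a unfolding cyclic_sumset_def by blast
  then show ?thesis
    by blast
qed

section \<open>Characteristic conditions and the conclusion\<close>

lemma of_nat_fact_neq_0:
  assumes "CHAR('a::field) = 0 \<or> k < CHAR('a)"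
  shows "of_nat (fact k) \<noteq> (0 :: 'a)"
  using assms
proof (induction k)
  case (Suc k)
  have "of_nat (Suc k) \<noteq> (0 :: 'a)"
    using Suc.prems unfolding of_nat_eq_0_iff_char_dvd by (auto dest: dvd_imp_le)
  with Suc show ?case
    by (simp only: fact_Suc of_nat_mult of_nat_id mult_eq_0_iff) auto
qed simp

theorem theorem1p2:
  fixes n :: nat and A :: "nat \<Rightarrow> 'a::field set"
  assumes "n > 0" and "even n"
    and "\<forall>i\<in>{1..n}. finite (A i)"
    and "\<forall>i\<in>{1..n}. \<forall>j\<in>{1..n}. card (A i) = card (A j)"
    and "\<forall>i\<in>{1..n}. card (A i) \<ge> 2"
    and "field_p TYPE('a) > enat ((\<Sum>i=1..n. card (A i)) - 2 * n)"
  shows "card (linear_sumset n A) \<ge> card (cyclic_sumset n A) \<and>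
         card (cyclic_sumset n A) \<ge> (\<Sum>i=1..n. card (A i)) - 2 * n + 1"
proof
  show "card (cyclic_sumset n A) \<le> card (linear_sumset n A)"
    using assms(3) by (intro card_mono finite_linear_sumset cyclic_subset_linear)
  define r where "r = card (A 1) - 1"
  have one: "1 \<in> {1..n}"
    using assms(1) by simp
  have r: "r \<ge> 1"
    using bspec[OF assms(5) one] by (simp add: r_def)
  have card: "card (A i) = Suc r" if "i \<in> {1..n}" for i
    using assms(4,5) one that unfolding r_def by (metis Suc_diff_1 One_nat_def less_le_trans pos2)
  have "(\<Sum>i=1..n. card (A i)) = n * Suc r"
    using card by simp
  then have N: "(\<Sum>i=1..n. card (A i)) - 2 * n = n * (r - 1)"
    by (simp add: algebra_simps)
  have "n * (r - 1) < card (cyclic_sumset n A)"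
  proof (cases "r = 1")
    case True
    have "cyclic_sumset n A \<noteq> {}"
      using assms(1-3) card True by (intro even_cycle_choosable) auto
    moreover have "finite (cyclic_sumset n A)"
      using assms(3) finite_linear_sumset cyclic_subset_linear by (metis finite_subset)
    ultimately show ?thesis
      using True by (simp add: card_gt_0_iff)
  next
    case False
    have p: "CHAR('a) = 0 \<or> n * (r - 1) < CHAR('a)"
      using assms(6) unfolding N field_p_def by (auto split: if_splits)
    \<comment> \<open>Here \<open>n \<ge> 2\<close> and \<open>r \<ge> 2\<close>, so both
      \<open>r\<close> and \<open>2\<close> are at most \<open>2 * (r - 1)\<close>, which is below a
      positive characteristic.\<close>
    have "2 * (r - 1) \<le> n * (r - 1)"
      using assms(1,2) by (intro mult_right_mono) auto
    then have "CHAR('a) = 0 \<or> r < CHAR('a) \<and> 2 < CHAR('a)"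
      using p r False by linarith
    then have "of_nat r \<noteq> (0 :: 'a)" "of_nat 2 \<noteq> (0 :: 'a)"
      using r unfolding of_nat_eq_0_iff_char_dvd by (auto dest: dvd_imp_le)
    then have "of_nat (2 * fact (n * (r - 1)) * r) \<noteq> (0 :: 'a)"
      using of_nat_fact_neq_0[OF p] unfolding of_nat_mult mult_eq_0_iff by blast
    then show ?thesis
      using assms(1-3) card r by (intro card_cyclic_sumset_gt) auto
  qed
  then show "(\<Sum>i=1..n. card (A i)) - 2 * n + 1 \<le> card (cyclic_sumset n A)"
    unfolding N by simp
qed

end
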